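(* Let $n,k$ be positive integers with $n\ge 2k$, let $t=n-2k+2$, and suppose $t>2$ is odd and $n\ge 4t^2-7t$. Then $$\psi(SG(n,k))=\left\lceil\frac t2\right\rceil+1.$$
   Context: The Schrijver graph $SG(n,k)$ has as vertices the $k$-element subsets $A\subseteq[n]=\{1,\dots,n\}$ that contain no two cyclically consecutive elements (i.e. $\{i,i+1\}\not\subseteq A$ for all $1\le i<n$ and $\{1,n\}\not\subseteq A$); two vertices are adjacent iff they are disjoint sets. For a graph $G$, $N(v)$ is the neighbourhood of $v$, and the local chromatic number is $\psi(G)=\min_c\max_{v\in V(G)}|\{c(u):u\in N(v)\}|+1$, minimum over all proper colorings $c$ of $G$. *)

theory Defs
  imports Complex_Main "Graph_Theory.Pair_Digraph"
begin

text \<open>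
  Undirected simple graphs are represented, as in the Graph-Theory library, by symmetric loop-free
  digraphs; for those, \<open>{u. (v, u) \<in> parcs G}\<close> is the set of vertices adjacent to \<open>v\<close>.
\<close>

definition neighbourhood :: "'a pair_pre_digraph \<Rightarrow> 'a \<Rightarrow> 'a set" where
  "neighbourhood G v = {u. (v, u) \<in> parcs G}"

text \<open>Colours are natural numbers, which is no restriction for finite graphs.
  Values of a colouring outside \<open>pverts G\<close> are irrelevant.\<close>

definition proper_coloring :: "'a pair_pre_digraph \<Rightarrow> ('a \<Rightarrow> nat) \<Rightarrow> bool" where
  "proper_coloring G c \<longleftrightarrow> (\<forall>u\<in>pverts G. \<forall>v\<in>pverts G. (u, v) \<in> parcs G \<longrightarrow> c u \<noteq> c v)"

text \<open>Meaningful for finite graphs with at least one vertex, since \<open>Max {}\<close> is unspecified.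
  The infimum over the natural numbers is a minimum, see \<open>local_chromatic_number_attained\<close>.\<close>

definition local_chromatic_number :: "'a pair_pre_digraph \<Rightarrow> nat" where
  "local_chromatic_number G =
     (INF c\<in>{c. proper_coloring G c}. Max ((\<lambda>v. card (c ` neighbourhood G v)) ` pverts G)) + 1"

definition schrijver_vertices :: "nat \<Rightarrow> nat \<Rightarrow> nat set set" where
  "schrijver_vertices n k =
     {A. A \<subseteq> {1..n} \<and> card A = k \<and>
         (\<forall>i. 1 \<le> i \<and> i < n \<longrightarrow> \<not> {i, i + 1} \<subseteq> A) \<and> \<not> {1, n} \<subseteq> A}"

definition schrijver_graph :: "nat \<Rightarrow> nat \<Rightarrow> nat set pair_pre_digraph" where
  "schrijver_graph n k =
     \<lparr> pverts = schrijver_vertices n k,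
       parcs = {(A, B). A \<in> schrijver_vertices n k \<and> B \<in> schrijver_vertices n k \<and> A \<inter> B = {}} \<rparr>"

lemma (in pair_graph) proper_coloring_exists: "\<exists>c. proper_coloring G c"
proof -
  obtain c :: "'a \<Rightarrow> nat" where "inj_on c (pverts G)"
    using finite_imp_inj_to_nat_seg[OF pair_finite_verts] by blast
  moreover have "u \<noteq> v" if "(u, v) \<in> parcs G" for u v
    using pair_no_loops[OF that] by simp
  ultimately have "proper_coloring G c"
    unfolding proper_coloring_def by (simp add: inj_on_eq_iff)
  then show ?thesis by blast
qed

lemma (in pair_graph) local_chromatic_number_attained:
  "\<exists>c. proper_coloring G c \<and>
     local_chromatic_number G = Max ((\<lambda>v. card (c ` neighbourhood G v)) ` pverts G) + 1"
proof -
  let ?f = "\<lambda>c. Max ((\<lambda>v. card (c ` neighbourhood G v)) ` pverts G)"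
  have "?f ` {c. proper_coloring G c} \<noteq> {}"
    using proper_coloring_exists by blast
  then have "Inf (?f ` {c. proper_coloring G c}) \<in> ?f ` {c. proper_coloring G c}"
    by (rule Inf_nat_def1)
  then obtain c where "proper_coloring G c" "Inf (?f ` {c. proper_coloring G c}) = ?f c"
    by (elim imageE CollectE) (rule that)
  then show ?thesis
    unfolding local_chromatic_number_def by (intro exI[of _ c]) simp
qed

lemma local_chromatic_number_le:
  "proper_coloring G c \<Longrightarrow>
     local_chromatic_number G \<le> Max ((\<lambda>v. card (c ` neighbourhood G v)) ` pverts G) + 1"
  unfolding local_chromatic_number_def by (intro add_right_mono cINF_lower) simp_all

lemma finite_schrijver_vertices: "finite (schrijver_vertices n k)"
proof (rule finite_subset)
  show "schrijver_vertices n k \<subseteq> Pow {1..n}"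
    unfolding schrijver_vertices_def by blast
qed simp

lemma schrijver_vertices_nonempty:
  assumes "n \<ge> 2 * k" "k \<ge> 1"
  shows "schrijver_vertices n k \<noteq> {}"
proof -
  define A where "A = (\<lambda>i. 2 * i + 1 :: nat) ` {..<k}"
  have A: "\<exists>j<k. i = 2 * j + 1" "odd i" if "i \<in> A" for i
    using that by (auto simp: A_def)
  have card: "card A = k"
    unfolding A_def by (subst card_image) (simp_all add: inj_on_def)
  have sub: "A \<subseteq> {1..n}"
  proof
    fix i assume "i \<in> A"
    then obtain j where "j < k" "i = 2 * j + 1" using A(1) by blast
    then show "i \<in> {1..n}" using assms by simp
  qed
  have cons: "\<not> {i, i + 1} \<subseteq> A" for i
  proof
    assume "{i, i + 1} \<subseteq> A"
    then have "i \<in> A" "i + 1 \<in> A" by simp_all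
    then have "odd i" "odd (i + 1)" using A(2) by blast+
    then show False by simp
  qed
  have "n \<notin> A"
  proof
    assume "n \<in> A"
    then obtain j where "j < k" "n = 2 * j + 1" using A(1) by blast
    then show False using assms by linarith
  qed
  then have "\<not> {1, n} \<subseteq> A" by blast
  then have "A \<in> schrijver_vertices n k"
    unfolding schrijver_vertices_def by (intro CollectI conjI allI impI sub card cons)
  then show ?thesis by blast
qed

lemma pair_graph_schrijver_graph:
  assumes "k \<ge> 1"
  shows "pair_graph (schrijver_graph n k)"
proof
  let ?V = "schrijver_vertices n k"
  show "finite (pverts (schrijver_graph n k))"
    by (simp add: schrijver_graph_def finite_schrijver_vertices)
  show "finite (parcs (schrijver_graph n k))"
  proof (rule finite_subset)
    show "parcs (schrijver_graph n k) \<subseteq> ?V \<times> ?V"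
      by (rule subrelI) (simp add: schrijver_graph_def)
    show "finite (?V \<times> ?V)"
      by (simp add: finite_schrijver_vertices)
  qed
  show "symmetric (with_proj (schrijver_graph n k))"
    unfolding symmetric_def with_proj_simps by (rule symI) (simp add: schrijver_graph_def Int_commute)
next
  fix e assume "e \<in> parcs (schrijver_graph n k)"
  then obtain A B where e: "e = (A, B)" "A \<in> schrijver_vertices n k" "B \<in> schrijver_vertices n k"
      "A \<inter> B = {}"
    unfolding schrijver_graph_def by (cases e) simp
  then show "fst e \<in> pverts (schrijver_graph n k)" "snd e \<in> pverts (schrijver_graph n k)"
    by (simp_all add: schrijver_graph_def)
  have "card A = k" using e(2) by (simp add: schrijver_vertices_def)
  then have "A \<noteq> {}" using assms by (intro notI) simp
  then show "fst e \<noteq> snd e" using e(1,4) by (intro notI) simp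
qed

end

theory Submission
  imports Defs "HOL-Library.Multiset" "HOL-Library.FuncSet"
begin

text \<open>
  Upper bound (after Simonyi and Tardos): cut \<open>{1..n}\<close> into \<open>t\<close> intervals of length \<open>4t - 7\<close> and a
  remainder. Every vertex fills some interval as densely as stability allows; colouring it by such
  an interval gives \<open>t\<close> colours for which the ends of a walk of length 5 always differ. A vertex
  is troubled if it sees more than \<open>t/2\<close> colours. Recolouring all neighbours of troubled vertices
  with a single new colour is proper, since two troubled vertices see a common colour.

  Lower bound: Ky Fan's lemma for the barycentric subdivision of the boundary of the cross-polytope,
  applied to the sign vectors labelled by the length of their longest alternating subsequence if it
  is below \<open>2k\<close>, and otherwise by the largest colour of a vertex inside the positive or the negative
  part. The large labels of an alternating chain yield a complete bipartite subgraph whose colours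
  alternate between the two sides; a smaller colour on the side opposite to the first large label
  extends the sequence by one.
\<close>

subsection \<open>Alternating label sequences\<close>

fun alternating :: "int \<Rightarrow> int list \<Rightarrow> bool" where
  "alternating s [] \<longleftrightarrow> True"
| "alternating s (x # xs) \<longleftrightarrow> sgn x = s \<and> (\<forall>y\<in>set xs. \<bar>x\<bar> < \<bar>y\<bar>) \<and> alternating (- s) xs"

lemma alternating_sorted_abs: "alternating s L \<Longrightarrow> sorted (map abs L)"
  by (induction s L rule: alternating.induct) auto

lemma alternating_uminus: "alternating s (map uminus L) \<longleftrightarrow> alternating (- s) L"
proof (induction L arbitrary: s)
  case (Cons x xs)
  have "sgn (- x) = s \<longleftrightarrow> sgn x = - s" by (auto simp: sgn_minus)
  with Cons show ?case by simp
qed simp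

lemma alternating_nth_less: "alternating s L \<Longrightarrow> i < j \<Longrightarrow> j < length L \<Longrightarrow> \<bar>L ! i\<bar> < \<bar>L ! j\<bar>"
proof (induction s L arbitrary: i j rule: alternating.induct)
  case (2 s x xs)
  then show ?case by (cases i; cases j) auto
qed simp

lemma alternating_sgn_nth: "alternating s L \<Longrightarrow> i < length L \<Longrightarrow> sgn (L ! i) = (if even i then s else - s)"
proof (induction s L arbitrary: i rule: alternating.induct)
  case (2 s x xs)
  then show ?case by (cases i) auto
qed simp

lemma alternating_distinct: "alternating s L \<Longrightarrow> distinct (map abs L)"
  by (induction s L rule: alternating.induct) auto

lemma alternating_take: "alternating s L \<Longrightarrow> alternating s (take r L)"
proof (induction s L arbitrary: r rule: alternating.induct)
  case (2 s x xs)
  then show ?case by (cases r) (auto dest: in_set_takeD)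
qed simp

text \<open>Absolute values increase along \<open>L\<close>, so the filter drops an initial segment;
  the parity of its length decides the new leading sign.\<close>

lemma alternating_filter_abs_ge:
  "alternating s L \<Longrightarrow> alternating s (filter (\<lambda>x. b \<le> \<bar>x\<bar>) L) \<or> alternating (- s) (filter (\<lambda>x. b \<le> \<bar>x\<bar>) L)"
proof (induction s L rule: alternating.induct)
  case (2 s x xs)
  show ?case
  proof (cases "b \<le> \<bar>x\<bar>")
    case True
    with 2 have "filter (\<lambda>x. b \<le> \<bar>x\<bar>) xs = xs" by (intro filter_True) force
    with 2 True show ?thesis by auto
  qed (use 2 in auto)
qed simp

text \<open>The local parity count of Fan's argument: each entry stands for the facet that omits it.
  The induction splits off the smallest label: omitting it leaves \<open>xs\<close>, while omitting
  another one keeps it in front and passes to the sign \<open>- s\<close>.\<close>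

lemma odd_card_alternating_facets_sorted:
  assumes "L \<noteq> []" "sorted (map abs L)" "\<forall>x\<in>set L. - x \<notin> set L" "s \<in> {1, - 1}"
  shows "odd (\<Sum>x\<leftarrow>L. of_bool (alternating s (remove1 x L)) :: nat)
    \<longleftrightarrow> alternating s L \<or> alternating (- s) L"
  using assms
proof (induction L arbitrary: s)
  case (Cons x xs)
  have x0: "x \<noteq> 0" using Cons.prems(3) by auto
  then have sx: "sgn x = s \<or> sgn x = - s"
    using Cons.prems(4) by (auto simp: sgn_if)
  have s0: "s \<noteq> - s" using Cons.prems(4) by auto
  show ?case
  proof (cases xs)
    case Nil
    then show ?thesis using sx by simp
  next
    case (Cons y ys)
    note ih = Cons.IH[of "- s"]
    show ?thesis
    proof (cases "\<bar>x\<bar> = \<bar>y\<bar>")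
      case True
      then have xy: "x = y" using Cons.prems(3) Cons by (auto simp: abs_eq_iff)
      \<comment> \<open>Two equal smallest labels: omitting a different label leaves both and
        destroys strict growth, while omitting either of the two gives the same list, so the total
        is even.\<close>
      define g where "g = (\<lambda>z. of_bool (alternating s (remove1 z (x # xs))) :: nat)"
      have "\<forall>z\<in>set ys. g z = 0 \<or> z = x"
        using xy Cons by (auto simp: g_def)
      moreover have "g x = 0" if "x \<in> set ys"
        using that xy Cons by (auto simp: g_def)
      ultimately have "(\<Sum>z\<leftarrow>ys. g z) = 0"
        unfolding sum_list_eq_0_iff by auto
      then have "even (\<Sum>z\<leftarrow>x # xs. g z)" using xy Cons by (metis even_add add_0_right list.simps(9) sum_list.Cons)
      moreover have "\<not> alternating e (x # xs)" for e using xy Cons by simp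
      ultimately show ?thesis unfolding g_def by blast
    next
      case False
      have lt: "\<bar>x\<bar> < \<bar>z\<bar>" if "z \<in> set xs" for z
        using that False Cons.prems(2) Cons by fastforce
      then have nin: "x \<notin> set xs" by auto
      define S where "S = (\<Sum>z\<leftarrow>xs. of_bool (alternating s (remove1 z (x # xs))) :: nat)"
      have tot: "(\<Sum>z\<leftarrow>x # xs. of_bool (alternating s (remove1 z (x # xs))) :: nat)
        = of_bool (alternating s xs) + S" by (simp add: S_def)
      have "S = (\<Sum>z\<leftarrow>xs. if sgn x = s then of_bool (alternating (- s) (remove1 z xs)) else 0)"
        unfolding S_def
      proof (intro arg_cong[where f = sum_list] map_cong refl)
        fix z assume "z \<in> set xs"
        then have "z \<noteq> x" using nin by auto
        moreover have "\<forall>u\<in>set (remove1 z xs). \<bar>x\<bar> < \<bar>u\<bar>"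
          using lt set_remove1_subset by fast
        ultimately show "of_bool (alternating s (remove1 z (x # xs)))
          = (if sgn x = s then of_bool (alternating (- s) (remove1 z xs)) else (0::nat))" by auto
      qed
      moreover have "odd (\<Sum>z\<leftarrow>xs. of_bool (alternating (- s) (remove1 z xs)) :: nat)
        \<longleftrightarrow> alternating (- s) xs \<or> alternating s xs"
      proof -
        have "xs \<noteq> []" using Cons by simp
        moreover have "sorted (map abs xs)" using Cons.prems(2) by simp
        moreover have "\<forall>x\<in>set xs. - x \<notin> set xs" using Cons.prems(3) by simp
        moreover have "- s \<in> {1, - 1}" using Cons.prems(4) by auto
        ultimately show ?thesis by (rule ih[unfolded minus_minus])
      qed
      \<comment> \<open>The first entry of the nonempty \<open>xs\<close> fixes its sign, so the two
        alternatives exclude each other and the parities combine as an exclusive or.\<close>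
      moreover have "\<not> (alternating s xs \<and> alternating (- s) xs)"
        using s0 unfolding Cons alternating.simps by metis
      moreover have "(\<Sum>z\<leftarrow>xs. 0) = (0 :: nat)" by simp
      ultimately have oddS: "odd S \<longleftrightarrow> sgn x = s \<and> (alternating (- s) xs \<or> alternating s xs)"
        and excl: "\<not> (alternating s xs \<and> alternating (- s) xs)"
        by (cases "sgn x = s"; simp only: if_True if_False simp_thms even_zero)+
      have "odd (of_bool (alternating s xs) + S) \<longleftrightarrow> alternating s xs \<noteq> odd S" by simp
      moreover have "alternating e (x # xs) \<longleftrightarrow> sgn x = e \<and> alternating (- e) xs" for e
        using lt by auto
      ultimately show ?thesis
        unfolding tot minus_minus using oddS excl sx s0 by (metis minus_minus)
    qed
  qed
qed simp

text \<open>Alternation refers to the order by absolute value and not to the order along a chain, so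
  the labels of a simplex are kept as a multiset.\<close>

definition alternating_mset :: "int \<Rightarrow> int multiset \<Rightarrow> bool" where
  "alternating_mset s M \<longleftrightarrow> (\<exists>L. mset L = M \<and> alternating s L)"

text \<open>Without opposite labels \<open>abs\<close> is injective on the entries, so the list
  sorted by absolute value is the only candidate for an alternating arrangement.\<close>

lemma alternating_mset_mset:
  assumes "sorted (map abs L)" "\<forall>x\<in>set L. - x \<notin> set L"
  shows "alternating_mset s (mset L) \<longleftrightarrow> alternating s L"
proof
  assume "alternating_mset s (mset L)"
  then obtain L' where L': "mset L' = mset L" "alternating s L'"
    unfolding alternating_mset_def by blast
  then have "sorted (map abs L')" by (simp add: alternating_sorted_abs)
  moreover have "mset (map abs L') = mset (map abs L)" using L' by simp
  ultimately have "map abs L' = map abs L" using assms(1) 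
    by (metis properties_for_sort)
  moreover have "set L' = set L" using L'(1) by (metis set_mset_mset)
  moreover have "inj_on abs (set L)" using assms(2) by (auto simp: inj_on_def abs_eq_iff)
  ultimately have "L' = L" by (metis map_inj_on sup.idem)
  then show "alternating s L" using L' by simp
qed (auto simp: alternating_mset_def)

lemma odd_card_alternating_facets:
  assumes "M \<noteq> {#}" "\<forall>x\<in>#M. - x \<notin># M" "s \<in> {1, - 1}"
  shows "odd (\<Sum>x\<in>#M. of_bool (alternating_mset s (M - {#x#})) :: nat)
    \<longleftrightarrow> alternating_mset s M \<or> alternating_mset (- s) M"
proof -
  obtain K where K: "mset K = M" using ex_mset by blast
  define L where "L = sort_key abs K"
  have L: "mset L = M" "sorted (map abs L)" using K by (auto simp: L_def)
  have nc: "\<forall>x\<in>set L. - x \<notin> set L" using assms(2) L(1) by auto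
  have "alternating_mset s (M - {#x#}) \<longleftrightarrow> alternating s (remove1 x L)" for x
  proof -
    have "M - {#x#} = mset (remove1 x L)" using L by simp
    moreover have "\<forall>y\<in>set (remove1 x L). - y \<notin> set (remove1 x L)"
      using nc set_remove1_subset by fast
    ultimately show ?thesis using alternating_mset_mset sorted_map_remove1[OF L(2)] by metis
  qed
  moreover have "sum_mset (image_mset f M) = sum_list (map f L)" for f :: "int \<Rightarrow> nat"
    using L(1) by (metis mset_map sum_mset_sum_list)
  moreover have "L \<noteq> []" using L assms(1) by auto
  ultimately show ?thesis
    using odd_card_alternating_facets_sorted[OF _ L(2) nc assms(3)]
      alternating_mset_mset[OF L(2) nc] L(1) by simp
qed

lemma even_card_involution:
  assumes "finite S" "\<And>x. x \<in> S \<Longrightarrow> f x \<in> S" "\<And>x. x \<in> S \<Longrightarrow> f (f x) = x" "\<And>x. x \<in> S \<Longrightarrow> f x \<noteq> x"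
  shows "even (card S)"
  using assms
proof (induction "card S" arbitrary: S rule: less_induct)
  case less
  show ?case
  proof (cases "S = {}")
    case False
    then obtain x where x: "x \<in> S" by blast
    let ?S = "S - {x, f x}"
    have c: "card S = card ?S + 2"
      using x less.prems card_Diff_subset[of "{x, f x}" S] card_mono[of S "{x, f x}"]
        card_2_iff[of "{x, f x}"] by fastforce
    have "f y \<in> ?S" if "y \<in> ?S" for y using that less.prems x by (metis DiffE DiffI insert_iff empty_iff)
    then have "even (card ?S)"
      using less.prems c by (intro less.hyps) auto
    then show ?thesis using c by simp
  qed simp
qed

subsection \<open>Ky Fan's lemma\<close>

text \<open>
  A sign vector is encoded by its set of signed indices, a set of integers without opposite elements.
  A maximal chain of sign vectors in dimension \<open>m\<close> is then the chain of prefixes of a signed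
  permutation of \<open>{1..m}\<close>.
\<close>

definition signed_perms :: "nat \<Rightarrow> int list set" where
  "signed_perms m = {w. distinct (map abs w) \<and> set (map abs w) = {1..int m}}"

definition signed_sets :: "nat \<Rightarrow> int set set" where
  "signed_sets n = {A. A \<noteq> {} \<and> 0 \<notin> A \<and> A \<subseteq> {- int n..int n} \<and> A \<inter> uminus ` A = {}}"

text \<open>Fan's hypotheses on the barycentric subdivision: an odd labelling without edges of
  opposite labels. The case \<open>A = B\<close> of the second clause excludes the label 0.\<close>

definition antipodal_labelling :: "nat \<Rightarrow> (int set \<Rightarrow> int) \<Rightarrow> bool" where
  "antipodal_labelling n l \<longleftrightarrow>
    (\<forall>A\<in>signed_sets n. l (uminus ` A) = - l A) \<and>
    (\<forall>A\<in>signed_sets n. \<forall>B\<in>signed_sets n. A \<subseteq> B \<longrightarrow> l A \<noteq> - l B)"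

text \<open>\<open>Suc\<close> skips the empty prefix, since the zero sign vector is not a vertex of
  the subdivision.\<close>

definition prefix_label :: "(int set \<Rightarrow> int) \<Rightarrow> int list \<Rightarrow> nat \<Rightarrow> int" where
  "prefix_label l w i = l (set (take (Suc i) w))"

definition prefix_labels :: "(int set \<Rightarrow> int) \<Rightarrow> int list \<Rightarrow> int multiset" where
  "prefix_labels l w = image_mset (prefix_label l w) (mset_set {..<length w})"

definition facet_labels :: "(int set \<Rightarrow> int) \<Rightarrow> int list \<Rightarrow> nat \<Rightarrow> int multiset" where
  "facet_labels l w j = image_mset (prefix_label l w) (mset_set ({..<length w} - {j}))"

lemma facet_labels_eq: "j < length w \<Longrightarrow> facet_labels l w j = prefix_labels l w - {#prefix_label l w j#}"
  unfolding facet_labels_def prefix_labels_def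
  by (simp add: mset_set_Diff image_mset_Diff)

section \<open>Signed permutations and the antipodal map\<close>

lemma length_signed_perms:
  assumes "w \<in> signed_perms m" shows "length w = m"
proof -
  have "card (set (map abs w)) = length w"
    using assms distinct_card[of "map abs w"] unfolding signed_perms_def by auto
  moreover have "card (set (map abs w)) = m" using assms unfolding signed_perms_def by simp
  ultimately show ?thesis by simp
qed

lemma signed_perms_abs: "w \<in> signed_perms m \<Longrightarrow> x \<in> set w \<Longrightarrow> 1 \<le> \<bar>x\<bar> \<and> \<bar>x\<bar> \<le> int m"
  unfolding signed_perms_def by (metis (mono_tags, lifting) atLeastAtMost_iff imageI list.set_map mem_Collect_eq)

lemma finite_signed_perms: "finite (signed_perms m)"
proof (rule finite_subset)
  show "signed_perms m \<subseteq> {w. set w \<subseteq> {- int m..int m} \<and> length w = m}"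
    using length_signed_perms signed_perms_abs by (fastforce simp: abs_le_iff)
qed (simp add: finite_lists_length_eq)

lemma signed_perms_no_opposite:
  assumes "w \<in> signed_perms m" "x \<in> set w" shows "- x \<notin> set w"
proof
  assume "- x \<in> set w"
  moreover have "inj_on abs (set w)" using assms by (simp add: signed_perms_def distinct_map)
  ultimately have "x = - x" using assms(2) inj_onD[of abs "set w" x "- x"] by simp
  then show False using signed_perms_abs[OF assms] by auto
qed

lemma signed_sets_prefix:
  assumes "w \<in> signed_perms m" "m \<le> n" "i < m"
  shows "set (take (Suc i) w) \<in> signed_sets n"
proof -
  have sub: "set (take (Suc i) w) \<subseteq> set w" by (rule set_take_subset)
  have "set (take (Suc i) w) \<noteq> {}" using length_signed_perms[OF assms(1)] assms by auto
  moreover have "x \<noteq> 0 \<and> x \<in> {- int n..int n}" if "x \<in> set w" for x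
    using signed_perms_abs[OF assms(1) that] assms(2) by auto
  moreover have "- x \<notin> set w" if "x \<in> set w" for x
    using signed_perms_no_opposite[OF assms(1) that] .
  ultimately show ?thesis using sub unfolding signed_sets_def by blast
qed

lemma signed_perms_uminus: "w \<in> signed_perms m \<Longrightarrow> map uminus w \<in> signed_perms m"
  unfolding signed_perms_def by (simp add: comp_def image_image)

lemma signed_perms_max_mem:
  assumes "w \<in> signed_perms m" "m > 0" shows "int m \<in> set w \<longleftrightarrow> - int m \<notin> set w"
proof -
  have "int m \<in> abs ` set w" using assms by (simp add: signed_perms_def)
  then have "int m \<in> set w \<or> - int m \<in> set w" by (auto simp: abs_if split: if_splits)
  then show ?thesis using signed_perms_no_opposite[OF assms(1)] by fastforce
qed

lemma prefix_label_uminus: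
  assumes "antipodal_labelling n l" "w \<in> signed_perms m" "m \<le> n" "i < m"
  shows "prefix_label l (map uminus w) i = - prefix_label l w i"
  using assms signed_sets_prefix[OF assms(2-4)]
  by (simp add: prefix_label_def antipodal_labelling_def take_map)

lemma alternating_mset_uminus:
  "alternating_mset s (image_mset uminus M) \<longleftrightarrow> alternating_mset (- s) M"
proof -
  have *: "alternating_mset s (image_mset uminus M)" if "alternating_mset (- s) M" for s M
    using that unfolding alternating_mset_def by (metis alternating_uminus mset_map)
  have "alternating_mset (- s) (image_mset uminus (image_mset uminus M))"
    if "alternating_mset s (image_mset uminus M)"
    by (rule *) (use that in simp)
  moreover have "image_mset uminus (image_mset uminus M) = M"
    by (simp add: image_mset.compositionality comp_def)
  ultimately show ?thesis using *[of s M] by auto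
qed

lemma prefix_labels_uminus:
  assumes "antipodal_labelling n l" "w \<in> signed_perms m" "m \<le> n"
  shows "prefix_labels l (map uminus w) = image_mset uminus (prefix_labels l w)"
  using assms prefix_label_uminus[OF assms] length_signed_perms[OF assms(2)]
  by (auto simp: prefix_labels_def image_mset.compositionality comp_def intro!: image_mset_cong)

lemma prefix_labels_no_opposite:
  assumes "antipodal_labelling n l" "w \<in> signed_perms m" "m \<le> n"
  shows "\<forall>x\<in>#prefix_labels l w. - x \<notin># prefix_labels l w"
proof -
  have "prefix_label l w i \<noteq> - prefix_label l w j" if "i < m" "j < m" for i j
  proof -
    have S: "set (take (Suc i) w) \<in> signed_sets n" "set (take (Suc j) w) \<in> signed_sets n"
      using signed_sets_prefix assms that by blast+
    show ?thesis
    proof (cases "i \<le> j")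
      case True
      then have "set (take (Suc i) w) \<subseteq> set (take (Suc j) w)" by (simp add: set_take_subset_set_take)
      then show ?thesis using S assms(1) unfolding prefix_label_def antipodal_labelling_def by blast
    next
      case False
      then have "set (take (Suc j) w) \<subseteq> set (take (Suc i) w)" by (simp add: set_take_subset_set_take)
      then have "prefix_label l w j \<noteq> - prefix_label l w i"
        using S assms(1) unfolding prefix_label_def antipodal_labelling_def by blast
      then show ?thesis by auto
    qed
  qed
  then show ?thesis
    using length_signed_perms[OF assms(2)] by (auto simp: prefix_labels_def) metis
qed

text \<open>Two arrangements would share their first entry, the label of smallest absolute value.
  Nonempty alternating simplices thus split into positive and negative ones.\<close>

lemma alternating_mset_unique_sgn:
  assumes "alternating_mset s M" "alternating_mset (- s) M" "s \<noteq> 0" shows "M = {#}"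
proof (rule ccontr)
  assume "M \<noteq> {#}"
  obtain L L' where L: "mset L = M" "alternating s L" "mset L' = M" "alternating (- s) L'"
    using assms unfolding alternating_mset_def by blast
  obtain x xs y ys where e: "L = x # xs" "L' = y # ys"
    using L \<open>M \<noteq> {#}\<close> by (cases L; cases L') auto
  have "x \<in> set L'" "y \<in> set L" using L e by (metis list.set_intros(1) set_mset_mset)+
  then have "x = y" using L e by auto (metis linorder_not_less order_less_imp_le)
  then show False using L e assms(3) by auto
qed

text \<open>Facets are indexed by positions. The sum over the multiset also runs once per position,
  so repeated labels count with the right multiplicity.\<close>

lemma odd_card_alternating_facet_labels:
  assumes "antipodal_labelling n l" "w \<in> signed_perms m" "m \<le> n" "m > 0"
  shows "odd (card {j. j < m \<and> alternating_mset 1 (facet_labels l w j)})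
    \<longleftrightarrow> alternating_mset 1 (prefix_labels l w) \<or> alternating_mset (- 1) (prefix_labels l w)"
proof -
  let ?M = "prefix_labels l w"
  have len: "length w = m" by (rule length_signed_perms) fact
  have "?M \<noteq> {#}" using len assms(4) by (auto simp: prefix_labels_def mset_set_empty_iff)
  have "{j. j < m \<and> alternating_mset 1 (facet_labels l w j)}
    = {..<m} \<inter> {j. alternating_mset 1 (facet_labels l w j)}" by auto
  then have "card {j. j < m \<and> alternating_mset 1 (facet_labels l w j)}
    = (\<Sum>j<m. of_bool (alternating_mset 1 (facet_labels l w j)))"
    by simp
  also have "\<dots> = (\<Sum>j<m. of_bool (alternating_mset 1 (?M - {#prefix_label l w j#})))"
    using len by (intro sum.cong) (simp_all add: facet_labels_eq)
  also have "\<dots> = (\<Sum>x\<in>#?M. of_bool (alternating_mset 1 (?M - {#x#})))"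
    by (simp only: prefix_labels_def len multiset.map_comp comp_def sum_unfold_sum_mset)
  finally show ?thesis
    using odd_card_alternating_facets[of ?M 1] \<open>?M \<noteq> {#}\<close> prefix_labels_no_opposite[OF assms(1-3)]
    by simp
qed

section \<open>Maximal simplices sharing a facet\<close>

lemma signed_perms_mset_cong: "mset w = mset w' \<Longrightarrow> w \<in> signed_perms m \<longleftrightarrow> w' \<in> signed_perms m"
proof -
  assume "mset w = mset w'"
  then have "mset (map abs w) = mset (map abs w')" by simp
  then have "distinct (map abs w) = distinct (map abs w')" "set (map abs w) = set (map abs w')"
    using mset_eq_imp_distinct_iff mset_eq_setD by blast+
  then show ?thesis unfolding signed_perms_def by simp
qed

text \<open>Only the prefix of length \<open>Suc j\<close> changes, so on signed permutations this
  leads to the other maximal chain through the facet opposite to vertex \<open>j\<close>.\<close>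

definition swap_adjacent :: "nat \<Rightarrow> 'a list \<Rightarrow> 'a list" where
  "swap_adjacent j w = w[j := w ! Suc j, Suc j := w ! j]"

lemma swap_adjacent:
  assumes "Suc j < length w"
  shows "length (swap_adjacent j w) = length w" "mset (swap_adjacent j w) = mset w"
    "swap_adjacent j (swap_adjacent j w) = w"
    "i \<noteq> j \<Longrightarrow> set (take (Suc i) (swap_adjacent j w)) = set (take (Suc i) w)"
    "distinct w \<Longrightarrow> swap_adjacent j w \<noteq> w"
proof -
  show "length (swap_adjacent j w) = length w" "mset (swap_adjacent j w) = mset w"
    using assms by (simp_all add: swap_adjacent_def mset_swap)
  show "swap_adjacent j (swap_adjacent j w) = w"
    using assms by (intro nth_equalityI) (simp_all add: swap_adjacent_def nth_list_update)
  show "set (take (Suc i) (swap_adjacent j w)) = set (take (Suc i) w)" if "i \<noteq> j"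
  proof (cases "i < j")
    case True
    then show ?thesis by (simp add: swap_adjacent_def)
  next
    case False
    show ?thesis
    proof (cases "Suc i < length w")
      case True
      let ?v = "take (Suc i) w"
      have "take (Suc i) (swap_adjacent j w) = ?v[j := ?v ! Suc j, Suc j := ?v ! j]"
        using False that True by (simp add: swap_adjacent_def take_update_swap)
      moreover have "mset (?v[j := ?v ! Suc j, Suc j := ?v ! j]) = mset ?v"
        using False that True by (intro mset_swap) auto
      ultimately show ?thesis by (metis set_mset_mset)
    next
      case False
      have "set (swap_adjacent j w) = set w"
        using \<open>mset (swap_adjacent j w) = mset w\<close> by (rule mset_eq_setD)
      then show ?thesis using False \<open>length (swap_adjacent j w) = length w\<close> by simp
    qed
  qed
  show "swap_adjacent j w \<noteq> w" if "distinct w"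
  proof
    assume "swap_adjacent j w = w"
    then have "swap_adjacent j w ! j = w ! j" by simp
    then have "w ! Suc j = w ! j" using assms by (simp add: swap_adjacent_def)
    then show False using assms that by (simp add: nth_eq_iff_index_eq)
  qed
qed

lemma facet_labels_cong:
  assumes "length w' = length w"
    and "\<And>i. i < length w \<Longrightarrow> i \<noteq> j \<Longrightarrow> set (take (Suc i) w') = set (take (Suc i) w)"
  shows "facet_labels l w' j = facet_labels l w j"
  unfolding facet_labels_def assms(1)
  by (intro image_mset_cong) (use assms in \<open>auto simp: prefix_label_def\<close>)

text \<open>
  Fan's parity argument, by induction on \<open>m\<close>, counts the pairs of a maximal simplex of the upper
  hemisphere and an alternating facet of it. Modulo 2 the count by simplices gives the
  alternating simplices of the whole sphere, since an alternating simplex with negative smallest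
  label is antipodal to one with positive smallest label. In the count by facets, interior
  facets cancel in pairs, and those in the equator remain.
\<close>

lemma odd_card_alternating_perms:
  assumes "antipodal_labelling n l" "m \<le> n"
  shows "odd (card {w \<in> signed_perms m. alternating_mset 1 (prefix_labels l w)})"
  using assms(2)
proof (induction m)
  case 0
  have "signed_perms 0 = {[]}" unfolding signed_perms_def by auto
  moreover have "alternating_mset 1 (prefix_labels l [])"
    by (auto simp: prefix_labels_def alternating_mset_def)
  ultimately have "{w \<in> signed_perms 0. alternating_mset 1 (prefix_labels l w)} = {[]}" by auto
  then show ?case by simp
next
  case (Suc m)
  let ?X = "signed_perms (Suc m)"
  define top where "top = int (Suc m)"
  \<comment> \<open>\<open>H\<close> holds the maximal simplices of the closed upper hemisphere,
    \<open>T\<close> their pairs with an alternating facet.\<close>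
  define H where "H = {w \<in> ?X. top \<in> set w}"
  define T where "T = (SIGMA w:H. {j. j < Suc m \<and> alternating_mset 1 (facet_labels l w j)})"
  \<comment> \<open>The excluded pairs are those with a facet in the equator: it omits the full sign
    vector of a chain whose last entry is \<open>top\<close>.\<close>
  define U where "U = {p \<in> T. \<not> (snd p = m \<and> fst p ! m = top)}"
  have fin: "finite H" by (simp add: H_def finite_signed_perms)
  then have finT: "finite T" unfolding T_def by auto
  have len: "length w = Suc m" if "w \<in> H" for w
    using that by (simp add: H_def length_signed_perms)
  have top: "top \<in> set w \<longleftrightarrow> - top \<notin> set w" if "w \<in> ?X" for w
    using signed_perms_max_mem[OF that] by (simp add: top_def)
  let ?pos = "\<lambda>w. alternating_mset 1 (prefix_labels l w)"
  let ?neg = "\<lambda>w. alternating_mset (- 1) (prefix_labels l w)"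

  have "card {w \<in> H. ?pos w \<or> ?neg w} = card {w \<in> ?X. ?pos w}"
  proof (rule bij_betw_same_card, rule bij_betwI)
    have um: "prefix_labels l (map uminus w) = image_mset uminus (prefix_labels l w)" if "w \<in> ?X" for w
      using prefix_labels_uminus[OF assms(1) that] Suc.prems by simp
    have np: "\<not> (?pos w \<and> ?neg w)" if "w \<in> ?X" for w
      using alternating_mset_unique_sgn[of 1 "prefix_labels l w"] length_signed_perms[OF that]
      by (auto simp: prefix_labels_def mset_set_empty_iff)
    let ?f = "\<lambda>w. if ?pos w then w else map uminus w"
    let ?g = "\<lambda>w. if top \<in> set w then w else map uminus w"
    have mt: "top \<in> uminus ` set w \<longleftrightarrow> - top \<in> set w" "- top \<in> uminus ` set w \<longleftrightarrow> top \<in> set w" for w :: "int list" by force+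
    have mm: "map uminus (map uminus w) = w" for w :: "int list" by (simp add: comp_def)
    show "?f \<in> {w \<in> H. ?pos w \<or> ?neg w} \<rightarrow> {w \<in> ?X. ?pos w}"
      using um signed_perms_uminus by (auto simp: H_def alternating_mset_uminus)
    show "?g \<in> {w \<in> ?X. ?pos w} \<rightarrow> {w \<in> H. ?pos w \<or> ?neg w}"
      using um signed_perms_uminus top mt by (auto simp: H_def alternating_mset_uminus)
    show "?g (?f w) = w" if "w \<in> {w \<in> H. ?pos w \<or> ?neg w}" for w
      using that top[of w] mt[of w] mm[of w] by (auto simp: H_def simp del: map_map)
    show "?f (?g w) = w" if "w \<in> {w \<in> ?X. ?pos w}" for w
      using that top[of w] mt[of w] mm[of w] np[of w] um[of w] by (auto simp: H_def alternating_mset_uminus simp del: map_map)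
  qed
  moreover have "odd (card T) \<longleftrightarrow> odd (card {w \<in> H. ?pos w \<or> ?neg w})"
  proof -
    have "card T = (\<Sum>w\<in>H. card {j. j < Suc m \<and> alternating_mset 1 (facet_labels l w j)})"
      unfolding T_def using fin by (intro card_SigmaI) auto
    moreover have "{w \<in> H. odd (card {j. j < Suc m \<and> alternating_mset 1 (facet_labels l w j)})}
      = {w \<in> H. ?pos w \<or> ?neg w}"
      using odd_card_alternating_facet_labels[OF assms(1) _ Suc.prems zero_less_Suc]
      unfolding H_def by blast
    ultimately show ?thesis by (simp only: even_sum_iff[OF fin])
  qed
  moreover have "even (card U)"
  proof -
    \<comment> \<open>For \<open>j = m\<close> the facet determines everything but the sign of the
      last entry. Reversing that sign keeps \<open>top\<close> in the list if the last entry is not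
      \<open>top\<close>.\<close>
    define flip where "flip = (\<lambda>w :: int list. w[m := - w ! m])"
    define \<phi> where "\<phi> = (\<lambda>(w, j). (if j < m then swap_adjacent j w else flip w, j))"
    have flip: "flip w \<in> H" "flip w ! m \<noteq> top" "flip w \<noteq> w" "flip (flip w) = w"
      "facet_labels l (flip w) m = facet_labels l w m" if w: "w \<in> H" "w ! m \<noteq> top" for w
    proof -
      have X: "w \<in> ?X" and t: "top \<in> set w" using w by (auto simp: H_def)
      have "map abs (flip w) = map abs w"
        using len[OF w(1)] by (intro nth_equalityI) (simp_all add: flip_def nth_list_update)
      then have "flip w \<in> ?X" using X unfolding signed_perms_def by (metis (mono_tags) mem_Collect_eq)
      moreover obtain i where i: "i < Suc m" "w ! i = top" using t len[OF w(1)] by (metis in_set_conv_nth)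
      then have "flip w ! i = top" "i < length (flip w)" using w len[OF w(1)] by (auto simp: flip_def nth_list_update)
      then have "top \<in> set (flip w)" by (metis nth_mem)
      ultimately show "flip w \<in> H" by (simp add: H_def)
      have "w ! m \<in> set w" using len[OF w(1)] by simp
      then have ne: "w ! m \<noteq> - top" "w ! m \<noteq> 0"
        using top[OF X] t signed_perms_abs[OF X, of "w ! m"] by (metis, metis abs_zero not_one_le_zero)
      have fm: "flip w ! m = - w ! m" using len[OF w(1)] by (simp add: flip_def)
      then show "flip w ! m \<noteq> top" using ne(1) by (metis minus_minus)
      show "flip w \<noteq> w" using fm ne(2) by (metis equal_neg_zero)
      show "flip (flip w) = w" using len[OF w(1)] by (simp add: flip_def)
      show "facet_labels l (flip w) m = facet_labels l w m"
        using len[OF w(1)] by (intro facet_labels_cong) (auto simp: flip_def)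
    qed
    have swap: "swap_adjacent j w \<in> H" "swap_adjacent j w \<noteq> w"
      "swap_adjacent j (swap_adjacent j w) = w"
      "facet_labels l (swap_adjacent j w) j = facet_labels l w j"
      if w: "w \<in> H" "j < m" for w j
    proof -
      note sw = swap_adjacent[of j w, unfolded len[OF w(1)]]
      have sm: "mset (swap_adjacent j w) = mset w" by (rule sw(2)) (use w in simp)
      then have "set (swap_adjacent j w) = set w" by (rule mset_eq_setD)
      then show "swap_adjacent j w \<in> H"
        using w(1) signed_perms_mset_cong[OF sm, of "Suc m"] unfolding H_def by simp
      have "distinct w" using w by (simp add: H_def signed_perms_def distinct_map)
      then show "swap_adjacent j w \<noteq> w" "swap_adjacent j (swap_adjacent j w) = w" using sw w by auto
      show "facet_labels l (swap_adjacent j w) j = facet_labels l w j"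
        using sw w len by (intro facet_labels_cong) auto
    qed
    show ?thesis
    proof (rule even_card_involution[where f = \<phi>])
      show "finite U" using finT by (simp add: U_def)
      fix p assume "p \<in> U"
      then obtain w j where p: "p = (w, j)" "w \<in> H" "j < Suc m" "alternating_mset 1 (facet_labels l w j)"
        "j = m \<Longrightarrow> w ! m \<noteq> top" by (auto simp: U_def T_def)
      then show "\<phi> p \<in> U" "\<phi> (\<phi> p) = p" "\<phi> p \<noteq> p"
        using flip[of w] swap[of w j] by (cases "j < m"; auto simp: \<phi>_def U_def T_def less_Suc_eq)+
    qed
  qed
  moreover have "card (T - U) = card {w \<in> signed_perms m. ?pos w}"
  proof -
    \<comment> \<open>A facet in the equator is a maximal simplex one dimension lower; appending
      \<open>top\<close> gives the only simplex of \<open>H\<close> on it.\<close>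
    let ?h = "\<lambda>w. (w @ [top], m)"
    have lab: "facet_labels l (w @ [top]) m = prefix_labels l w" if "length w = m" for w
      unfolding facet_labels_def prefix_labels_def using that
      by (auto simp: prefix_label_def lessThan_Suc intro!: image_mset_cong)
    have app: "w @ [top] \<in> ?X \<longleftrightarrow> w \<in> signed_perms m" for w
    proof -
      have "{1..int (Suc m)} = insert top {1..int m}" "top \<notin> {1..int m}" by (auto simp: top_def)
      moreover have "\<bar>top\<bar> = top" by (simp add: top_def)
      ultimately show ?thesis unfolding signed_perms_def by auto
    qed
    have "T - U = ?h ` {w \<in> signed_perms m. ?pos w}"
    proof (intro equalityI subsetI)
      fix p assume "p \<in> T - U"
      then obtain w where p: "p = (w, m)" "w \<in> H" "alternating_mset 1 (facet_labels l w m)" "w ! m = top"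
        by (cases p) (auto simp: U_def T_def)
      have "w = take m w @ [top]" using len[OF p(2)] p(4) by (metis lessI take_Suc_conv_app_nth take_all order_refl)
      then obtain v where v: "w = v @ [top]" by blast
      then have "length v = m" using len[OF p(2)] by simp
      then show "p \<in> ?h ` {w \<in> signed_perms m. ?pos w}"
        using p app[of v] lab[of v] v by (auto simp: H_def)
    next
      fix p assume "p \<in> ?h ` {w \<in> signed_perms m. ?pos w}"
      then obtain w where "p = (w @ [top], m)" "w \<in> signed_perms m" "?pos w" by blast
      then show "p \<in> T - U"
        using app[of w] lab[of w] length_signed_perms[of w m]
        by (auto simp: H_def U_def T_def nth_append)
    qed
    then show ?thesis by (simp add: card_image inj_on_def)
  qed
  moreover have "card T = card (T - U) + card U"
  proof -
    have "U \<subseteq> T" by (auto simp: U_def)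
    then show ?thesis
      using finT card_Diff_subset[of U T] card_mono[of T U] finite_subset[of U T] by linarith
  qed
  moreover have "odd (card {w \<in> signed_perms m. ?pos w})" using Suc.IH Suc.prems by linarith
  ultimately show ?case by (metis even_add)
qed

text \<open>An odd number is not zero, so a positive alternating maximal simplex exists. Its
  \<open>n\<close> labels have distinct absolute values.\<close>

theorem ky_fan_octahedral:
  assumes "antipodal_labelling n l"
  obtains w L where "w \<in> signed_perms n" "alternating 1 L"
    "mset L = image_mset (\<lambda>i. l (set (take (Suc i) w))) (mset_set {..<n})"
proof -
  have "{w \<in> signed_perms n. alternating_mset 1 (prefix_labels l w)} \<noteq> {}"
    using odd_card_alternating_perms[OF assms order_refl] by (metis card.empty even_zero)
  then obtain w where w: "w \<in> signed_perms n" "alternating_mset 1 (prefix_labels l w)" by blast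
  then obtain L where L: "mset L = prefix_labels l w" "alternating 1 L"
    by (auto simp: alternating_mset_def)
  show ?thesis
  proof (rule that[OF w(1) L(2)])
    show "mset L = image_mset (\<lambda>i. l (set (take (Suc i) w))) (mset_set {..<n})"
      using L(1) length_signed_perms[OF w(1)] by (simp add: prefix_labels_def prefix_label_def[abs_def])
  qed
qed

subsection \<open>The lower bound\<close>

definition has_alternating :: "int \<Rightarrow> nat \<Rightarrow> int set \<Rightarrow> bool" where
  "has_alternating s r A \<longleftrightarrow> (\<exists>L. alternating s L \<and> length L = r \<and> set L \<subseteq> A)"

text \<open>Indices are ordered by absolute value, so an alternating list in \<open>A\<close> is a
  subsequence of the sign vector. For finite \<open>A\<close> the maximum exists, as 0 occurs and
  \<open>card A\<close> is a bound.\<close>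

definition alt_size :: "int set \<Rightarrow> nat" where
  "alt_size A = Max {r. has_alternating 1 r A \<or> has_alternating (- 1) r A}"

lemma has_alternating_mono: "has_alternating s r A \<Longrightarrow> A \<subseteq> B \<Longrightarrow> has_alternating s r B"
  unfolding has_alternating_def by blast

lemma has_alternating_le: "has_alternating s r A \<Longrightarrow> r' \<le> r \<Longrightarrow> has_alternating s r' A"
  unfolding has_alternating_def
  by (metis alternating_take length_take min.absorb2 order_trans set_take_subset)

lemma has_alternating_uminus: "has_alternating s r (uminus ` A) \<longleftrightarrow> has_alternating (- s) r A"
proof -
  have *: "has_alternating s r (uminus ` A)" if H: "has_alternating (- s) r A" for s A
  proof -
    obtain L where "alternating (- s) L" "length L = r" "set L \<subseteq> A"
      using H unfolding has_alternating_def by blast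
    then have "alternating s (map uminus L) \<and> length (map uminus L) = r \<and> set (map uminus L) \<subseteq> uminus ` A"
      by (auto simp: alternating_uminus)
    then show ?thesis unfolding has_alternating_def by blast
  qed
  have "has_alternating (- s) r (uminus ` (uminus ` A))" if "has_alternating s r (uminus ` A)"
    by (rule *) (use that in simp)
  then show ?thesis using *[of s A] by (auto simp: image_image)
qed

lemma has_alternating_card:
  assumes "has_alternating s r A" "finite A" shows "r \<le> card A"
proof -
  obtain L where L: "alternating s L" "length L = r" "set L \<subseteq> A"
    using assms unfolding has_alternating_def by blast
  then have "distinct L" using alternating_distinct distinct_map by blast
  then show ?thesis using L card_mono[OF assms(2) L(3)] by (simp add: distinct_card)
qed

text \<open>The leading entry of smaller absolute value can be put in front of the whole other
  sequence. Hence longest sequences cannot occur with both leading signs.\<close>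

lemma has_alternating_extend:
  assumes "has_alternating s (Suc r) A" "has_alternating (- s) (Suc r) A" "A \<inter> uminus ` A = {}" "s \<noteq> 0"
  shows "has_alternating s (Suc (Suc r)) A \<or> has_alternating (- s) (Suc (Suc r)) A"
proof -
  obtain x xs where x: "alternating s (x # xs)" "length xs = r" "set (x # xs) \<subseteq> A"
    using assms(1) unfolding has_alternating_def by (metis length_Suc_conv)
  obtain y ys where y: "alternating (- s) (y # ys)" "length ys = r" "set (y # ys) \<subseteq> A"
    using assms(2) unfolding has_alternating_def by (metis length_Suc_conv)
  have "x \<noteq> - y" using x y assms(3) by auto
  moreover have "x \<noteq> y" using x y assms(4) by auto
  ultimately consider "\<bar>x\<bar> < \<bar>y\<bar>" | "\<bar>y\<bar> < \<bar>x\<bar>" by linarith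
  then show ?thesis
  proof cases
    case 1
    then have "alternating s (x # y # ys)" using x(1) y(1) by force
    then show ?thesis unfolding has_alternating_def using x y
      by (intro disjI1 exI[of _ "x # y # ys"]) auto
  next
    case 2
    then have "alternating (- s) (y # x # xs)" using x(1) y(1) by force
    then show ?thesis unfolding has_alternating_def using x y
      by (intro disjI2 exI[of _ "y # x # xs"]) auto
  qed
qed

lemma finite_signed_set: "A \<in> signed_sets n \<Longrightarrow> finite A"
  unfolding signed_sets_def using finite_subset by blast

lemma
  assumes "finite A"
  shows alt_size_attained: "has_alternating 1 (alt_size A) A \<or> has_alternating (- 1) (alt_size A) A"
    and alt_size_ge: "has_alternating 1 r A \<or> has_alternating (- 1) r A \<Longrightarrow> r \<le> alt_size A"
proof -
  let ?R = "{r. has_alternating 1 r A \<or> has_alternating (- 1) r A}"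
  have "?R \<subseteq> {..card A}" using has_alternating_card assms by auto
  then have fin: "finite ?R" by (rule finite_subset) simp
  have "has_alternating 1 0 A" unfolding has_alternating_def by (intro exI[of _ "[]"]) simp
  then have "?R \<noteq> {}" by blast
  then show "has_alternating 1 (alt_size A) A \<or> has_alternating (- 1) (alt_size A) A"
    using Max_in[OF fin] unfolding alt_size_def by blast
  show "r \<le> alt_size A" if "has_alternating 1 r A \<or> has_alternating (- 1) r A"
    using Max_ge[OF fin] that unfolding alt_size_def by blast
qed

lemma alt_size_uminus: "alt_size (uminus ` A) = alt_size A"
  unfolding alt_size_def has_alternating_uminus by (simp add: disj_commute)

lemma alt_size_sgn_unique:
  assumes "A \<in> signed_sets n"
  shows "0 < alt_size A"
    and "has_alternating 1 (alt_size A) A \<longleftrightarrow> \<not> has_alternating (- 1) (alt_size A) A"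
proof -
  have fin: "finite A" by (rule finite_signed_set) fact
  obtain x where x: "x \<in> A" "x \<noteq> 0" using assms unfolding signed_sets_def by blast
  have "has_alternating (sgn x) 1 A"
    unfolding has_alternating_def using x by (intro exI[of _ "[x]"]) auto
  then have "has_alternating 1 1 A \<or> has_alternating (- 1) 1 A" using x by (auto simp: sgn_if split: if_splits)
  then show pos: "0 < alt_size A" using alt_size_ge[OF fin] by fastforce
  then obtain r where r: "alt_size A = Suc r" using gr0_implies_Suc by blast
  have "A \<inter> uminus ` A = {}" using assms unfolding signed_sets_def by blast
  then have "\<not> (has_alternating 1 (Suc r) A \<and> has_alternating (- 1) (Suc r) A)"
    using has_alternating_extend[of 1 r A] alt_size_ge[OF fin, of "Suc (Suc r)"] r by auto
  then show "has_alternating 1 (alt_size A) A \<longleftrightarrow> \<not> has_alternating (- 1) (alt_size A) A"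
    using alt_size_attained[OF fin] r by auto
qed

text \<open>Between two chosen entries lies one of the opposite sign, which makes the set stable; the
  cyclic condition holds because the last (or the first) entry has the opposite sign.\<close>

lemma alternating_schrijver_vertex:
  assumes L: "alternating s L" "length L = 2 * k" "\<And>x. x \<in> set L \<Longrightarrow> 1 \<le> \<bar>x\<bar> \<and> \<bar>x\<bar> \<le> int n"
    and k: "k \<ge> 1" and p: "p < 2"
  shows "(\<lambda>q. nat \<bar>L ! (2 * q + p)\<bar>) ` {..<k} \<in> schrijver_vertices n k"
proof -
  define a where "a = (\<lambda>i. nat \<bar>L ! i\<bar>)"
  have a: "1 \<le> a i" "a i \<le> n" if "i < 2 * k" for i
    using L(3)[of "L ! i"] that L(2) by (auto simp: a_def)
  have less: "a i < a j" if "i < j" "j < 2 * k" for i j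
    using alternating_nth_less[OF L(1) that(1)] that L(2) by (auto simp: a_def)
  define f where "f = (\<lambda>q. a (2 * q + p))"
  have step: "f q + 2 \<le> f q'" if "q < q'" "q' < k" for q q'
    using less[of "2 * q + p" "2 * q + p + 1"] less[of "2 * q + p + 1" "2 * q' + p"] that p
    by (simp add: f_def)
  have lt: "q < q' \<or> q = q' \<or> q' < q" for q q' :: nat by linarith
  have "strict_mono_on {..<k} f" using step by (intro strict_mono_onI) fastforce
  then have "inj_on f {..<k}" by (rule strict_mono_on_imp_inj_on)
  then have "card (f ` {..<k}) = k" by (simp add: card_image)
  moreover have "f ` {..<k} \<subseteq> {1..n}" using a p by (auto simp: f_def)
  moreover have "\<not> {i, i + 1} \<subseteq> f ` {..<k}" for i
  proof
    assume "{i, i + 1} \<subseteq> f ` {..<k}"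
    then obtain q q' where q: "q < k" "q' < k" "f q = i" "f q' = i + 1" by auto
    then show False using step[of q q'] step[of q' q] lt[of q q'] by auto
  qed
  moreover have "\<not> {1, n} \<subseteq> f ` {..<k}"
  proof
    assume "{1, n} \<subseteq> f ` {..<k}"
    then obtain q q' where q: "q < k" "q' < k" "f q = 1" "f q' = n" by auto
    show False
    proof (cases "p = 0")
      case True
      then show ?thesis using q less[of "2 * q'" "2 * q' + 1"] a[of "2 * q' + 1"] by (simp add: f_def)
    next
      case False
      then have "p = 1" using p by simp
      then show ?thesis using q less[of "2 * q" "2 * q + 1"] a[of "2 * q"] by (simp add: f_def)
    qed
  qed
  ultimately have "f ` {..<k} \<in> schrijver_vertices n k" unfolding schrijver_vertices_def by blast
  then show ?thesis by (simp add: f_def a_def)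
qed

section \<open>The labelling given by a proper colouring\<close>

definition side_colors :: "nat \<Rightarrow> nat \<Rightarrow> (nat set \<Rightarrow> nat) \<Rightarrow> int \<Rightarrow> int set \<Rightarrow> nat set" where
  "side_colors n k c e A = c ` {S \<in> schrijver_vertices n k. (\<lambda>x. e * int x) ` S \<subseteq> A}"

text \<open>Colours start at 0, so the offset \<open>2 * k\<close> keeps the absolute values of the
  large labels apart from those of the small ones. The sign names the side that holds the larger
  colour.\<close>

definition schrijver_label :: "nat \<Rightarrow> nat \<Rightarrow> (nat set \<Rightarrow> nat) \<Rightarrow> int set \<Rightarrow> int" where
  "schrijver_label n k c A =
    (if alt_size A < 2 * k then
       if has_alternating 1 (alt_size A) A then int (alt_size A) else - int (alt_size A)
     else if Max (side_colors n k c (- 1) A) < Max (side_colors n k c 1 A)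
       then int (2 * k + Max (side_colors n k c 1 A))
       else - int (2 * k + Max (side_colors n k c (- 1) A)))"

lemma finite_side_colors: "finite (side_colors n k c e A)"
  unfolding side_colors_def by (simp add: finite_schrijver_vertices)

lemma side_colors_mono: "A \<subseteq> B \<Longrightarrow> side_colors n k c e A \<subseteq> side_colors n k c e B"
  unfolding side_colors_def by blast

lemma side_colors_uminus: "side_colors n k c e (uminus ` A) = side_colors n k c (- e) A"
proof -
  have "(\<lambda>x. e * int x) ` S \<subseteq> uminus ` A \<longleftrightarrow> (\<lambda>x. - e * int x) ` S \<subseteq> A" for S
  proof -
    have "e * int x \<in> uminus ` A \<longleftrightarrow> - e * int x \<in> A" for x
      by (metis (no_types, lifting) image_iff minus_minus mult_minus_left)
    then show ?thesis by blast
  qed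
  then show ?thesis unfolding side_colors_def by simp
qed

text \<open>An alternating sequence of length \<open>2 * k\<close> has \<open>k\<close> entries of
  each sign, and either half is a vertex. So both maxima in the large labels range over nonempty
  sets.\<close>

lemma side_colors_nonempty:
  assumes A: "A \<in> signed_sets n" and "2 * k \<le> alt_size A" and k: "k \<ge> 1" and e: "e \<in> {1, - 1}"
  shows "side_colors n k c e A \<noteq> {}"
proof -
  have fin: "finite A" by (rule finite_signed_set) fact
  obtain s where s: "s \<in> {1, - 1}" "has_alternating s (2 * k) A"
    using alt_size_attained[OF fin] has_alternating_le[OF _ assms(2)] by blast
  then obtain L where L: "alternating s L" "length L = 2 * k" "set L \<subseteq> A"
    unfolding has_alternating_def by blast
  have Lb: "1 \<le> \<bar>x\<bar> \<and> \<bar>x\<bar> \<le> int n" if "x \<in> set L" for x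
  proof -
    have "x \<in> {- int n..int n}" "x \<noteq> 0" using that L(3) A unfolding signed_sets_def by auto
    then show ?thesis by auto
  qed
  \<comment> \<open>Entries of sign \<open>e\<close> sit at the even positions if the sequence
    starts with \<open>e\<close>, and at the odd ones otherwise.\<close>
  define p :: nat where "p = (if s = e then 0 else 1)"
  let ?S = "(\<lambda>q. nat \<bar>L ! (2 * q + p)\<bar>) ` {..<k}"
  have "?S \<in> schrijver_vertices n k"
    by (rule alternating_schrijver_vertex[OF L(1,2) Lb k]) (simp_all add: p_def)
  moreover have "e * int (nat \<bar>L ! (2 * q + p)\<bar>) \<in> A" if "q < k" for q
  proof -
    have i: "2 * q + p < length L" using that L(2) by (simp add: p_def)
    then have "sgn (L ! (2 * q + p)) = e"
      using alternating_sgn_nth[OF L(1) i] s(1) e by (auto simp: p_def)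
    then have "e * \<bar>L ! (2 * q + p)\<bar> = L ! (2 * q + p)" by (metis mult.commute abs_mult_sgn)
    then show ?thesis using L(3) nth_mem[OF i] by auto
  qed
  ultimately show ?thesis unfolding side_colors_def by blast
qed

text \<open>Vertices inside opposite parts of a sign vector are disjoint sets, hence adjacent: the
  two sides form a complete bipartite subgraph.\<close>

lemma side_colors_disjoint:
  assumes "proper_coloring (schrijver_graph n k) c" "A \<inter> uminus ` A = {}"
  shows "side_colors n k c e A \<inter> side_colors n k c (- e) A = {}"
proof -
  have "c S \<noteq> c S'" if S: "S \<in> schrijver_vertices n k" "S' \<in> schrijver_vertices n k"
    "(\<lambda>x. e * int x) ` S \<subseteq> A" "(\<lambda>x. - e * int x) ` S' \<subseteq> A" for S S'
  proof -
    have "S \<inter> S' = {}"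
    proof (rule ccontr)
      assume "S \<inter> S' \<noteq> {}"
      then obtain x where "e * int x \<in> A" "- (e * int x) \<in> A" using S by auto
      then show False using assms(2) by force
    qed
    then show ?thesis
      using assms(1) S unfolding proper_coloring_def schrijver_graph_def by simp
  qed
  then show ?thesis unfolding side_colors_def by blast
qed

text \<open>Disjoint colour sets cannot share their maximum, so there is no tie. The sign
  \<open>e\<close> lets both branches be treated at once.\<close>

lemma schrijver_label_large:
  assumes c: "proper_coloring (schrijver_graph n k) c" and A: "A \<in> signed_sets n" and k: "k \<ge> 1"
    and "2 * k \<le> alt_size A"
  obtains e where "e \<in> {1, - 1}" "Max (side_colors n k c (- e) A) < Max (side_colors n k c e A)"
    "schrijver_label n k c A = e * int (2 * k + Max (side_colors n k c e A))"
proof -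
  have "A \<inter> uminus ` A = {}" using A unfolding signed_sets_def by blast
  then have "Max (side_colors n k c 1 A) \<noteq> Max (side_colors n k c (- 1) A)"
    using side_colors_disjoint[OF c, of A 1] Max_in[OF finite_side_colors side_colors_nonempty[OF A assms(4) k]]
    by (metis disjoint_iff insertCI)
  then show ?thesis
    using that[of 1] that[of "- 1"] assms(4) unfolding schrijver_label_def
    by (cases "Max (side_colors n k c (- 1) A) < Max (side_colors n k c 1 A)") auto
qed

lemma schrijver_label_small:
  assumes A: "A \<in> signed_sets n" and "alt_size A < 2 * k"
  obtains e where "e \<in> {1, - 1}" "has_alternating e (alt_size A) A"
    "schrijver_label n k c A = e * int (alt_size A)"
  using that[of 1] that[of "- 1"] alt_size_sgn_unique(2)[OF A] assms(2) unfolding schrijver_label_def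
  by (cases "has_alternating 1 (alt_size A) A") auto

text \<open>The absolute value of a label reveals its branch, so opposite labels come from the same
  branch.\<close>

lemma schrijver_label_abs_less:
  assumes "proper_coloring (schrijver_graph n k) c" "A \<in> signed_sets n" "k \<ge> 1"
  shows "\<bar>schrijver_label n k c A\<bar> < int (2 * k) \<longleftrightarrow> alt_size A < 2 * k"
proof (cases "alt_size A < 2 * k")
  case True
  then show ?thesis by (rule schrijver_label_small[OF assms(2), of k c]) (use True in \<open>auto simp: abs_mult\<close>)
next
  case False
  then have "2 * k \<le> alt_size A" by simp
  then show ?thesis by (rule schrijver_label_large[OF assms]) (use False in \<open>auto simp: abs_mult\<close>)
qed

text \<open>Suppose \<open>A \<subseteq> B\<close> have opposite labels. Small labels would give
  \<open>B\<close> longest alternating sequences with both leading signs; large ones would put one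
  colour on both sides of \<open>B\<close>.\<close>

lemma antipodal_labelling_schrijver_label:
  assumes c: "proper_coloring (schrijver_graph n k) c" and k: "k \<ge> 1"
  shows "antipodal_labelling n (schrijver_label n k c)"
  unfolding antipodal_labelling_def
proof (intro conjI ballI impI)
  fix A assume A: "A \<in> signed_sets n"
  show "schrijver_label n k c (uminus ` A) = - schrijver_label n k c A"
  proof (cases "alt_size A < 2 * k")
    case True
    then show ?thesis
      using alt_size_sgn_unique(2)[OF A]
      unfolding schrijver_label_def alt_size_uminus has_alternating_uminus by simp
  next
    case False
    then have "2 * k \<le> alt_size A" by simp
    then show ?thesis
    proof (rule schrijver_label_large[OF c A k])
      fix e assume "e \<in> {1, - 1 :: int}" "Max (side_colors n k c (- e) A) < Max (side_colors n k c e A)"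
        "schrijver_label n k c A = e * int (2 * k + Max (side_colors n k c e A))"
      \<comment> \<open>A tie would fall into the negative branch for \<open>A\<close> and for its
        antipode alike; the strict inequality prevents this.\<close>
      then show ?thesis using False unfolding schrijver_label_def alt_size_uminus side_colors_uminus by auto
    qed
  qed
next
  fix A B assume A: "A \<in> signed_sets n" and B: "B \<in> signed_sets n" and AB: "A \<subseteq> B"
  show "schrijver_label n k c A \<noteq> - schrijver_label n k c B"
  proof
    assume eq: "schrijver_label n k c A = - schrijver_label n k c B"
    then have "alt_size A < 2 * k \<longleftrightarrow> alt_size B < 2 * k"
      using schrijver_label_abs_less[OF c A k] schrijver_label_abs_less[OF c B k] by simp
    then consider "alt_size A < 2 * k" "alt_size B < 2 * k" | "2 * k \<le> alt_size A" "2 * k \<le> alt_size B"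
      by linarith
    then show False
    proof cases
      case 1
      obtain e where e: "e \<in> {1, - 1}" "has_alternating e (alt_size A) A"
        "schrijver_label n k c A = e * int (alt_size A)" by (rule schrijver_label_small[OF A 1(1)])
      obtain f where f: "f \<in> {1, - 1}" "has_alternating f (alt_size B) B"
        "schrijver_label n k c B = f * int (alt_size B)" by (rule schrijver_label_small[OF B 1(2)])
      have "alt_size A = alt_size B \<and> e = - f"
        using eq e(1,3) f(1,3) alt_size_sgn_unique(1)[OF A] alt_size_sgn_unique(1)[OF B] by auto
      then show False
        using has_alternating_mono[OF e(2) AB] f(1,2) alt_size_sgn_unique(2)[OF B] by auto
    next
      case 2
      obtain e where e: "e \<in> {1, - 1}"
        "schrijver_label n k c A = e * int (2 * k + Max (side_colors n k c e A))"
        by (rule schrijver_label_large[OF c A k 2(1)])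
      obtain f where f: "f \<in> {1, - 1}"
        "schrijver_label n k c B = f * int (2 * k + Max (side_colors n k c f B))"
        by (rule schrijver_label_large[OF c B k 2(2)])
      have ef: "f = - e \<and> Max (side_colors n k c e A) = Max (side_colors n k c (- e) B)"
        using eq e f k by auto
      have "Max (side_colors n k c e A) \<in> side_colors n k c e B"
        using Max_in[OF finite_side_colors side_colors_nonempty[OF A 2(1) k e(1)]]
          side_colors_mono[OF AB] by blast
      moreover have "Max (side_colors n k c (- e) B) \<in> side_colors n k c (- e) B"
        using Max_in[OF finite_side_colors side_colors_nonempty[OF B 2(2) k f(1)]] ef by simp
      moreover have "B \<inter> uminus ` B = {}" using B unfolding signed_sets_def by blast
      ultimately show False using side_colors_disjoint[OF c] ef by (metis disjoint_iff)
    qed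
  qed
qed

section \<open>Many colours in one neighbourhood\<close>

lemma schrijver_neighbourhood_colors:
  assumes c: "proper_coloring (schrijver_graph n k) c" and k: "k \<ge> 1" and n: "n \<ge> 2 * k"
  obtains v where "v \<in> schrijver_vertices n k"
    "(n - 2 * k + 1) div 2 + 1 \<le> card (c ` neighbourhood (schrijver_graph n k) v)"
proof -
  let ?l = "schrijver_label n k c"
  obtain w L where w: "w \<in> signed_perms n" and L: "alternating 1 L"
    "mset L = image_mset (\<lambda>i. ?l (set (take (Suc i) w))) (mset_set {..<n})"
    by (rule ky_fan_octahedral[OF antipodal_labelling_schrijver_label[OF c k]])
  define B where "B = set w"
  have "set (take (Suc (n - 1)) w) = B" using length_signed_perms[OF w] n k by (simp add: B_def)
  then have B: "B \<in> signed_sets n" using signed_sets_prefix[OF w order_refl, of "n - 1"] n k by simp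
  then have Bo: "B \<inter> uminus ` B = {}" unfolding signed_sets_def by blast
  have prefix: "\<exists>A\<in>signed_sets n. A \<subseteq> B \<and> ?l A = x" if "x \<in> set L" for x
  proof -
    have "set L = (\<lambda>i. ?l (set (take (Suc i) w))) ` {..<n}"
      using arg_cong[OF L(2), of set_mset] by simp
    then obtain i where "i < n" "x = ?l (set (take (Suc i) w))" using \<open>x \<in> set L\<close> by auto
    then show ?thesis
      using signed_sets_prefix[OF w order_refl \<open>i < n\<close>] set_take_subset[of "Suc i" w]
      unfolding B_def by blast
  qed
  have lenL: "length L = n" using arg_cong[OF L(2), of size] by simp

  define K where "K = filter (\<lambda>x. int (2 * k) \<le> \<bar>x\<bar>) L"
  obtain e where e: "e \<in> {1, - 1}" "alternating e K"
    using alternating_filter_abs_ge[OF L(1)] unfolding K_def by blast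
  \<comment> \<open>The small labels have distinct absolute values between 1 and
    \<open>2 * k - 1\<close>; all other labels of the chain are in \<open>K\<close>.\<close>
  have lenK: "n - 2 * k + 1 \<le> length K"
  proof -
    let ?K' = "filter (\<lambda>x. \<not> int (2 * k) \<le> \<bar>x\<bar>) L"
    have "distinct (map abs ?K')" using alternating_distinct[OF L(1)] by (simp add: distinct_map_filter)
    from distinct_card[OF this] have "card (set (map abs ?K')) = length ?K'" by simp
    moreover have "set (map abs ?K') \<subseteq> {1..<int (2 * k)}"
    proof
      fix y assume "y \<in> set (map abs ?K')"
      then obtain x where x: "y = \<bar>x\<bar>" "x \<in> set L" "\<bar>x\<bar> < int (2 * k)" by auto
      obtain A where A: "A \<in> signed_sets n" "?l A = x" using prefix[OF x(2)] by blast
      \<comment> \<open>This excludes the label 0.\<close>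
      have "?l A \<noteq> - ?l A"
        using antipodal_labelling_schrijver_label[OF c k] A(1) unfolding antipodal_labelling_def by blast
      then show "y \<in> {1..<int (2 * k)}" using x A by auto
    qed
    then have "card (set (map abs ?K')) \<le> card {1..<int (2 * k)}" by (intro card_mono) simp_all
    moreover have "card {1..<int (2 * k)} = 2 * k - 1" by simp
    ultimately have "length ?K' \<le> 2 * k - 1" by linarith
    moreover have "length K + length ?K' = n"
      using sum_length_filter_compl[of _ L] lenL unfolding K_def by metis
    ultimately show ?thesis using n k by linarith
  qed
  \<comment> \<open>Removing the offset recovers the colours behind the large labels; they increase
    along \<open>K\<close>.\<close>
  define m where "m = (\<lambda>i. nat \<bar>K ! i\<bar> - 2 * k)"
  have m_less: "m i < m j" if "i < j" "j < length K" for i j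
  proof -
    have "K ! i \<in> set K" using that by simp
    then have "int (2 * k) \<le> \<bar>K ! i\<bar>" by (simp add: K_def)
    then show ?thesis using alternating_nth_less[OF e(2) that] unfolding m_def by linarith
  qed
  \<comment> \<open>A large label of a prefix \<open>A\<close> records the maximum of one side; the
    maximum of the other side is the smaller colour \<open>d\<close>. Both colours persist in the
    full sign vector \<open>B\<close>.\<close>
  have m_col: "m i \<in> side_colors n k c (sgn (K ! i)) B \<and> (\<exists>d\<in>side_colors n k c (- sgn (K ! i)) B. d < m i)"
    if "i < length K" for i
  proof -
    have "K ! i \<in> set K" using that by simp
    then have Ki: "K ! i \<in> set L" "int (2 * k) \<le> \<bar>K ! i\<bar>" by (simp_all add: K_def)
    obtain A where A: "A \<in> signed_sets n" "A \<subseteq> B" "?l A = K ! i" using prefix[OF Ki(1)] by blast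
    have big: "2 * k \<le> alt_size A" using schrijver_label_abs_less[OF c A(1) k] Ki A by simp
    obtain f where f: "f \<in> {1, - 1}" "Max (side_colors n k c (- f) A) < Max (side_colors n k c f A)"
      "?l A = f * int (2 * k + Max (side_colors n k c f A))"
      by (rule schrijver_label_large[OF c A(1) k big])
    have fK: "sgn (K ! i) = f" "m i = Max (side_colors n k c f A)"
      using f A(3) k by (auto simp: m_def sgn_mult abs_mult)
    have "Max (side_colors n k c g A) \<in> side_colors n k c g B" if "g \<in> {1, - 1}" for g
      using Max_in[OF finite_side_colors side_colors_nonempty[OF A(1) big k that]]
        side_colors_mono[OF A(2)] by (rule subsetD[rotated])
    from this[of f] this[of "- f"]
    have "Max (side_colors n k c f A) \<in> side_colors n k c f B"
      "Max (side_colors n k c (- f) A) \<in> side_colors n k c (- f) B"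
      using f(1) by auto
    then show ?thesis using f(2) unfolding fK by blast
  qed

  \<comment> \<open>The entries of \<open>K\<close> at odd positions have sign \<open>- e\<close>,
    and there are at least \<open>q\<close> of them.\<close>
  define q where "q = (n - 2 * k + 1) div 2"
  have q: "2 * i + 1 < length K" if "i < q" for i using that lenK unfolding q_def by linarith
  have len0: "0 < length K" using lenK by linarith
  have "sgn (K ! 0) = e" using alternating_sgn_nth[OF e(2) len0] by simp
  then obtain d where m0: "m 0 \<in> side_colors n k c e B" and d: "d \<in> side_colors n k c (- e) B" "d < m 0"
    using m_col[OF len0] by auto
  \<comment> \<open>A vertex on the side of the first entry sees the whole other side. There
    \<open>d < m 0\<close> lies below all colours at odd positions and so is an additional
    one.\<close>
  obtain v where v: "v \<in> schrijver_vertices n k" "(\<lambda>x. e * int x) ` v \<subseteq> B"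
    using m0 unfolding side_colors_def by blast
  have "side_colors n k c (- e) B \<subseteq> c ` neighbourhood (schrijver_graph n k) v"
  proof
    fix y assume "y \<in> side_colors n k c (- e) B"
    then obtain u where u: "u \<in> schrijver_vertices n k" "(\<lambda>x. - e * int x) ` u \<subseteq> B" "y = c u"
      unfolding side_colors_def by blast
    have "v \<inter> u = {}"
    proof (rule ccontr)
      assume "v \<inter> u \<noteq> {}"
      then obtain x where "e * int x \<in> B" "- (e * int x) \<in> B" using u v by auto
      then show False using Bo by force
    qed
    then show "y \<in> c ` neighbourhood (schrijver_graph n k) v"
      using u v(1) unfolding neighbourhood_def schrijver_graph_def by auto
  qed
  moreover have "insert d ((\<lambda>i. m (2 * i + 1)) ` {..<q}) \<subseteq> side_colors n k c (- e) B"
  proof -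
    have "m (2 * i + 1) \<in> side_colors n k c (- e) B" if "i < q" for i
      using m_col[OF q[OF that]] alternating_sgn_nth[OF e(2) q[OF that]] by simp
    then show ?thesis using d(1) by blast
  qed
  moreover have "card (insert d ((\<lambda>i. m (2 * i + 1)) ` {..<q})) = q + 1"
  proof -
    have "strict_mono_on {..<q} (\<lambda>i. m (2 * i + 1))"
      using m_less q by (intro strict_mono_onI) simp
    then have "inj_on (\<lambda>i. m (2 * i + 1)) {..<q}" by (rule strict_mono_on_imp_inj_on)
    moreover have "d < m (2 * i + 1)" if "i < q" for i
      using d(2) m_less[of 0 "2 * i + 1"] q[OF that] by simp
    then have "d \<notin> (\<lambda>i. m (2 * i + 1)) ` {..<q}" by fastforce
    ultimately show ?thesis by (simp add: card_image)
  qed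
  moreover have "finite (c ` neighbourhood (schrijver_graph n k) v)"
  proof -
    have "neighbourhood (schrijver_graph n k) v \<subseteq> schrijver_vertices n k"
      unfolding neighbourhood_def schrijver_graph_def by auto
    then show ?thesis using finite_subset finite_schrijver_vertices by blast
  qed
  ultimately have "q + 1 \<le> card (c ` neighbourhood (schrijver_graph n k) v)"
    using card_mono[of "c ` neighbourhood (schrijver_graph n k) v"
        "insert d ((\<lambda>i. m (2 * i + 1)) ` {..<q})"] by (metis subset_trans)
  then show ?thesis using that v(1) unfolding q_def by blast
qed

subsection \<open>The upper bound\<close>

lemma local_chromatic_number_le_of_wide_coloring:
  fixes c\<^sub>0 :: "'a \<Rightarrow> nat"
  assumes G: "pair_graph G" "pverts G \<noteq> {}" and c\<^sub>0: "c\<^sub>0 ` pverts G \<subseteq> {..<t}"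
    and wide: "\<And>x\<^sub>0 x\<^sub>1 x\<^sub>2 x\<^sub>3 x\<^sub>4 x\<^sub>5. (x\<^sub>0, x\<^sub>1) \<in> parcs G \<Longrightarrow> (x\<^sub>1, x\<^sub>2) \<in> parcs G \<Longrightarrow>
      (x\<^sub>2, x\<^sub>3) \<in> parcs G \<Longrightarrow> (x\<^sub>3, x\<^sub>4) \<in> parcs G \<Longrightarrow> (x\<^sub>4, x\<^sub>5) \<in> parcs G \<Longrightarrow> c\<^sub>0 x\<^sub>0 \<noteq> c\<^sub>0 x\<^sub>5"
  shows "local_chromatic_number G \<le> t div 2 + 2"
proof -
  interpret pair_graph G by fact
  have sym: "(y, x) \<in> parcs G" if "(x, y) \<in> parcs G" for x y
    using that by (rule arcs_symmetric)
  have nb: "neighbourhood G v \<subseteq> pverts G" for v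
    unfolding neighbourhood_def using in_arcsD2 by blast
  have colN: "c\<^sub>0 ` neighbourhood G v \<subseteq> {..<t}" for v
    using nb c\<^sub>0 by blast
  then have fin: "finite (c\<^sub>0 ` neighbourhood G v)" for v
    using finite_subset by blast
  define troubled where "troubled v \<longleftrightarrow> t div 2 < card (c\<^sub>0 ` neighbourhood G v)" for v
  define c where "c u = (if \<exists>v. (v, u) \<in> parcs G \<and> troubled v then t else c\<^sub>0 u)" for u
  have "proper_coloring G c"
    unfolding proper_coloring_def
  proof (intro ballI impI notI)
    fix x y assume x: "x \<in> pverts G" and y: "y \<in> pverts G" and xy: "(x, y) \<in> parcs G" and eq: "c x = c y"
    have lt: "c\<^sub>0 x < t" "c\<^sub>0 y < t" using x y c\<^sub>0 by auto
    show False
    proof (cases "(\<exists>v. (v, x) \<in> parcs G \<and> troubled v) \<and> (\<exists>w. (w, y) \<in> parcs G \<and> troubled w)")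
      case True
      then obtain v w where v: "(v, x) \<in> parcs G" "troubled v" and w: "(w, y) \<in> parcs G" "troubled w"
        by blast
      let ?A = "c\<^sub>0 ` neighbourhood G v" and ?B = "c\<^sub>0 ` neighbourhood G w"
      \<comment> \<open>Two sets of more than \<open>t div 2\<close> among \<open>t\<close> colours
        must meet.\<close>
      have "card (?A \<union> ?B) \<le> card {..<t}" using colN by (intro card_mono) auto
      then have "card (?A \<inter> ?B) \<noteq> 0"
        using card_Un_Int[OF fin[of v] fin[of w]] v(2) w(2) unfolding troubled_def card_lessThan by linarith
      then have "?A \<inter> ?B \<noteq> {}" by (metis card.empty)
      then obtain a b where "(v, a) \<in> parcs G" "(w, b) \<in> parcs G" "c\<^sub>0 a = c\<^sub>0 b"
        unfolding neighbourhood_def by auto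
      \<comment> \<open>The walk \<open>a, v, x, y, w, b\<close> of length 5 would have ends of
        equal colour.\<close>
      then show False using wide[OF sym v(1) xy sym] w(1) by blast
    next
      case False
      \<comment> \<open>Old colours lie below \<open>t\<close>, so neither end was recoloured; going
        back and forth along the edge is a walk of length 5 from \<open>x\<close> to
        \<open>y\<close>.\<close>
      then have "c\<^sub>0 x = c\<^sub>0 y" using eq lt by (auto simp: c_def split: if_splits)
      then show False using wide[OF xy sym[OF xy] xy sym[OF xy] xy] by simp
    qed
  qed
  then have "local_chromatic_number G \<le> Max ((\<lambda>v. card (c ` neighbourhood G v)) ` pverts G) + 1"
    by (rule local_chromatic_number_le)
  also have "Max ((\<lambda>v. card (c ` neighbourhood G v)) ` pverts G) \<le> t div 2 + 1"
  proof -
    \<comment> \<open>A troubled vertex sees at most the new colour \<open>t\<close>, any other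
      vertex at most \<open>t div 2\<close> old colours besides \<open>t\<close>.\<close>
    have "card (c ` neighbourhood G v) \<le> t div 2 + 1" for v
    proof (cases "troubled v")
      case True
      then have "c ` neighbourhood G v \<subseteq> {t}" by (auto simp: c_def neighbourhood_def)
      then have "card (c ` neighbourhood G v) \<le> card {t}" by (intro card_mono) auto
      then show ?thesis by simp
    next
      case False
      have "c ` neighbourhood G v \<subseteq> insert t (c\<^sub>0 ` neighbourhood G v)" by (auto simp: c_def)
      then have "card (c ` neighbourhood G v) \<le> card (insert t (c\<^sub>0 ` neighbourhood G v))"
        using fin by (intro card_mono) auto
      also have "\<dots> \<le> card (c\<^sub>0 ` neighbourhood G v) + 1" using card_insert_le_m1 fin by (simp add: card_insert_if)
      finally show ?thesis using False by (simp add: troubled_def)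
    qed
    then show ?thesis using G(2) pair_finite_verts by (subst Max_le_iff) auto
  qed
  finally show ?thesis by simp
qed

section \<open>Dense stable sets in intervals\<close>

lemma
  fixes S :: "nat set"
  assumes S: "S \<subseteq> {a + 1..a + m}" and stable: "\<And>i. i \<in> S \<Longrightarrow> Suc i \<notin> S"
  shows card_stable_le: "2 * card S \<le> m + 1"
    and stable_cover: "2 * card S = m + 1 \<Longrightarrow> S \<union> Suc ` S = {a + 1..a + m + 1}"
proof -
  have fin: "finite S" using S finite_subset by blast
  \<comment> \<open>\<open>S\<close> and its shift are disjoint and fit into an interval of length
    \<open>m + 1\<close>; in the extremal case they fill it.\<close>
  have "S \<inter> Suc ` S = {}" using stable by auto
  then have card: "card (S \<union> Suc ` S) = 2 * card S"
    using fin by (simp add: card_Un_disjoint card_image)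
  have sub: "S \<union> Suc ` S \<subseteq> {a + 1..a + m + 1}" using S by auto
  show "2 * card S \<le> m + 1" using card_mono[OF _ sub] card by simp
  show "S \<union> Suc ` S = {a + 1..a + m + 1}" if "2 * card S = m + 1"
    using card_subset_eq[OF _ sub] card that by simp
qed

text \<open>In the extremal case every point of the interval belongs to \<open>S\<close> or follows
  a member of \<open>S\<close>. From the left end, which follows no member, this forces every second
  point into \<open>S\<close>.\<close>

lemma stable_contains_alternate:
  fixes S :: "nat set"
  assumes S: "S \<subseteq> {a + 1..a + (2 * p - 1)}" and stable: "\<And>i. i \<in> S \<Longrightarrow> Suc i \<notin> S"
    and "p \<le> card S" and "q < p"
  shows "a + 1 + 2 * q \<in> S"
proof -
  have "2 * card S \<le> (2 * p - 1) + 1" by (rule card_stable_le[OF S]) (rule stable)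
  then have full: "2 * card S = (2 * p - 1) + 1" using assms(3,4) by simp
  have cover: "S \<union> Suc ` S = {a + 1..a + (2 * p - 1) + 1}"
    by (rule stable_cover[OF S _ full]) (rule stable)
  show ?thesis
    using \<open>q < p\<close>
  proof (induction q)
    case 0
    then have "a + 1 \<in> S \<union> Suc ` S" unfolding cover by simp
    then show ?case using S by auto
  next
    case (Suc q)
    then have "a + 1 + 2 * q \<in> S" by simp
    then have "Suc (a + 1 + 2 * q) \<notin> S" using stable by blast
    moreover have "Suc (Suc (a + 1 + 2 * q)) \<in> S \<union> Suc ` S" unfolding cover using Suc.prems by simp
    ultimately show ?case by auto
  qed
qed

text \<open>The sets \<open>A - C\<close>, \<open>C\<close> and \<open>B\<close> are pairwise
  disjoint in \<open>{1..n}\<close>. So two steps of a walk replace at most \<open>n - 2 * k\<close>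
  elements.\<close>

lemma schrijver_common_neighbour:
  assumes "A \<in> schrijver_vertices n k" "B \<in> schrijver_vertices n k" "C \<in> schrijver_vertices n k"
    and "A \<inter> B = {}" "B \<inter> C = {}"
  shows "card (A - C) \<le> n - 2 * k"
proof -
  have AC: "A \<subseteq> {1..n}" "B \<subseteq> {1..n}" "C \<subseteq> {1..n}" "card A = k" "card B = k" "card C = k"
    using assms(1-3) unfolding schrijver_vertices_def by auto
  then have fin: "finite A" "finite B" "finite C" using finite_subset by blast+
  have "card (((A - C) \<union> C) \<union> B) \<le> card {1..n}" using AC by (intro card_mono) auto
  moreover have "card (((A - C) \<union> C) \<union> B) = card (A - C) + card C + card B"
    using fin assms(4,5) by (subst card_Un_disjoint; (subst card_Un_disjoint)?; auto)
  ultimately show ?thesis using AC by simp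
qed

text \<open>For positive \<open>p\<close> this is the only stable set of \<open>p\<close> elements
  in the \<open>i\<close>-th interval of length \<open>2 * p - 1\<close>, counting intervals from
  0.\<close>

definition odd_block :: "nat \<Rightarrow> nat \<Rightarrow> nat set" where
  "odd_block p i = (\<lambda>q. i * (2 * p - 1) + 1 + 2 * q) ` {..<p}"

lemma card_odd_block: "card (odd_block p i) = p"
  unfolding odd_block_def by (simp add: card_image inj_on_def)

text \<open>Pigeonhole: a stable set fills at most half of the remainder beyond the \<open>t\<close> odd intervals,
  because that remainder has even length.\<close>

lemma schrijver_vertex_contains_odd_block:
  assumes A: "A \<in> schrijver_vertices n k" and k: "k \<ge> 1" and p: "p \<ge> 1"
    and n: "n + 2 = 2 * k + t" and len: "t * (2 * p - 1) \<le> n"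
  shows "\<exists>i<t. odd_block p i \<subseteq> A"
proof (rule ccontr)
  assume neg: "\<not> (\<exists>i<t. odd_block p i \<subseteq> A)"
  define d where "d = 2 * p - 1"
  define I where "I i = {i * d + 1..i * d + d}" for i
  have AV: "A \<subseteq> {1..n}" "card A = k" using A unfolding schrijver_vertices_def by auto
  have stable: "Suc i \<notin> A" if "i \<in> A" for i
  proof
    assume "Suc i \<in> A"
    then have "1 \<le> i" "i < n" "{i, i + 1} \<subseteq> A" using that AV by auto
    then show False using A unfolding schrijver_vertices_def by blast
  qed
  have small: "card (A \<inter> I i) \<le> p - 1" if "i < t" for i
  proof (rule ccontr)
    assume "\<not> card (A \<inter> I i) \<le> p - 1"
    then have "p \<le> card (A \<inter> I i)" by simp
    then have "i * d + 1 + 2 * q \<in> A \<inter> I i" if "q < p" for q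
      using stable_contains_alternate[of "A \<inter> I i" "i * d" p q] stable that by (auto simp: I_def d_def)
    then have "odd_block p i \<subseteq> A" unfolding odd_block_def d_def by auto
    then show False using neg that by blast
  qed
  have td: "t * d \<le> n" using len by (simp add: d_def)
  have "2 * card (A \<inter> {t * d + 1..t * d + (n - t * d)}) \<le> (n - t * d) + 1"
    by (rule card_stable_le) (use stable in auto)
  moreover have "t * d + (n - t * d) = n" using td by simp
  ultimately have "2 * card (A \<inter> {t * d + 1..n}) \<le> (n - t * d) + 1" by simp
  \<comment> \<open>The remainder has even length, so the \<open>+ 1\<close> of the preceding bound
    is lost on halving. With at most \<open>p - 1\<close> elements per interval, only
    \<open>k - 1\<close> elements fit in total.\<close>
  moreover have "n = 2 * (k - 1 - t * (p - 1)) + t * d" "t * (p - 1) \<le> k - 1"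
  proof -
    have "t * d + t = 2 * (t * (p - 1)) + 2 * t" using p by (cases p) (auto simp: d_def algebra_simps)
    then show "n = 2 * (k - 1 - t * (p - 1)) + t * d" "t * (p - 1) \<le> k - 1"
      using td n k by linarith+
  qed
  ultimately have rest: "card (A \<inter> {t * d + 1..n}) \<le> k - 1 - t * (p - 1)" by linarith
  have "A \<subseteq> (\<Union>i<t. A \<inter> I i) \<union> (A \<inter> {t * d + 1..n})"
  proof
    fix x assume x: "x \<in> A"
    show "x \<in> (\<Union>i<t. A \<inter> I i) \<union> (A \<inter> {t * d + 1..n})"
    proof (cases "x \<le> t * d")
      case True
      have d: "d > 0" using p by (simp add: d_def)
      have x1: "1 \<le> x" using x AV by auto
      define i where "i = (x - 1) div d"
      have "i < t" unfolding i_def using True x1 d by (subst div_less_iff_less_mult) auto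
      moreover have "x - 1 = i * d + (x - 1) mod d" "(x - 1) mod d < d" using d by (simp_all add: i_def)
      then have "x \<in> I i" unfolding I_def using x1 by auto
      ultimately show ?thesis using x by blast
    next
      case False
      then show ?thesis using x AV by auto
    qed
  qed
  then have "card A \<le> card ((\<Union>i<t. A \<inter> I i) \<union> (A \<inter> {t * d + 1..n}))"
    by (intro card_mono) (auto simp: I_def)
  also have "\<dots> \<le> card (\<Union>i<t. A \<inter> I i) + card (A \<inter> {t * d + 1..n})" by (rule card_Un_le)
  also have "card (\<Union>i<t. A \<inter> I i) \<le> (\<Sum>i<t. card (A \<inter> I i))" by (rule card_UN_le) simp
  also have "\<dots> \<le> t * (p - 1)" using sum_bounded_above[of "{..<t}" "\<lambda>i. card (A \<inter> I i)" "p - 1"] small by simp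
  finally have "k \<le> t * (p - 1) + (k - 1 - t * (p - 1))" using rest AV by linarith
  then show False using \<open>t * (p - 1) \<le> k - 1\<close> k by linarith
qed

section \<open>A wide colouring by filled intervals\<close>

lemma local_chromatic_number_schrijver_le:
  assumes k: "k \<ge> 1" and n: "n + 2 = 2 * k + t" and t: "t \<ge> 2" and len: "t * (4 * t - 7) \<le> n"
  shows "local_chromatic_number (schrijver_graph n k) \<le> t div 2 + 2"
proof -
  let ?G = "schrijver_graph n k" and ?V = "schrijver_vertices n k"
  \<comment> \<open>Four steps of a walk remove at most \<open>2 * (n - 2 * k) = 2 * (t - 2)\<close>
    elements, so a block with one element more cannot vanish. The intervals then have length
    \<open>4 * t - 7\<close>.\<close>
  define p where "p = 2 * (t - 2) + 1"
  have "2 * p - 1 = 4 * t - 7" "p \<ge> 1" using t by (auto simp: p_def)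
  then have "\<exists>i<t. odd_block p i \<subseteq> A" if "A \<in> ?V" for A
    using schrijver_vertex_contains_odd_block[OF that k _ n] len by simp
  then obtain c\<^sub>0 where c\<^sub>0: "c\<^sub>0 A < t" "odd_block p (c\<^sub>0 A) \<subseteq> A" if "A \<in> ?V" for A
    by metis
  have arc: "A \<in> ?V" "B \<in> ?V" "A \<inter> B = {}" if "(A, B) \<in> parcs ?G" for A B
    using that unfolding schrijver_graph_def by auto
  show ?thesis
  proof (rule local_chromatic_number_le_of_wide_coloring)
    show "pair_graph ?G" using k by (rule pair_graph_schrijver_graph)
    show "pverts ?G \<noteq> {}"
      using schrijver_vertices_nonempty[of k n] n t k by (simp add: schrijver_graph_def)
    show "c\<^sub>0 ` pverts ?G \<subseteq> {..<t}" using c\<^sub>0(1) by (auto simp: schrijver_graph_def)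
    fix A\<^sub>0 A\<^sub>1 A\<^sub>2 A\<^sub>3 A\<^sub>4 A\<^sub>5
    assume w: "(A\<^sub>0, A\<^sub>1) \<in> parcs ?G" "(A\<^sub>1, A\<^sub>2) \<in> parcs ?G" "(A\<^sub>2, A\<^sub>3) \<in> parcs ?G" "(A\<^sub>3, A\<^sub>4) \<in> parcs ?G" "(A\<^sub>4, A\<^sub>5) \<in> parcs ?G"
    show "c\<^sub>0 A\<^sub>0 \<noteq> c\<^sub>0 A\<^sub>5"
    proof
      assume eq: "c\<^sub>0 A\<^sub>0 = c\<^sub>0 A\<^sub>5"
      have "finite A" if "A \<in> ?V" for A
        using that finite_subset[of A "{1..n}"] unfolding schrijver_vertices_def by auto
      then have fin: "finite A\<^sub>0" "finite A\<^sub>2" using arc(1) w by blast+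
      \<comment> \<open>With equal colours the block also lies in \<open>A\<^sub>5\<close>, which is
        disjoint from \<open>A\<^sub>4\<close>, so four steps would remove it completely.\<close>
      have "odd_block p (c\<^sub>0 A\<^sub>0) \<subseteq> A\<^sub>0 - A\<^sub>4"
        using c\<^sub>0(2)[OF arc(1)[OF w(1)]] c\<^sub>0(2)[OF arc(2)[OF w(5)]] arc(3)[OF w(5)] eq by auto
      also have "\<dots> \<subseteq> (A\<^sub>0 - A\<^sub>2) \<union> (A\<^sub>2 - A\<^sub>4)" by blast
      finally have "p \<le> card ((A\<^sub>0 - A\<^sub>2) \<union> (A\<^sub>2 - A\<^sub>4))"
        using card_mono[of "(A\<^sub>0 - A\<^sub>2) \<union> (A\<^sub>2 - A\<^sub>4)" "odd_block p (c\<^sub>0 A\<^sub>0)"] fin card_odd_block by simp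
      also have "\<dots> \<le> card (A\<^sub>0 - A\<^sub>2) + card (A\<^sub>2 - A\<^sub>4)" by (rule card_Un_le)
      also have "\<dots> \<le> (n - 2 * k) + (n - 2 * k)"
        using schrijver_common_neighbour[OF arc(1)[OF w(1)] arc(1,2)[OF w(2)] arc(3)[OF w(1)] arc(3)[OF w(2)]]
          schrijver_common_neighbour[OF arc(1)[OF w(3)] arc(1,2)[OF w(4)] arc(3)[OF w(3)] arc(3)[OF w(4)]]
        by (rule add_mono)
      finally show False using n t by (simp add: p_def)
    qed
  qed
qed

section \<open>The two bounds combined\<close>

theorem theorem2p3:
  fixes n k t :: nat
  assumes "n \<ge> 1" and "k \<ge> 1" and "n \<ge> 2 * k"
    and "t = n - 2 * k + 2"
    and "t > 2" and "odd t"
    and "int n \<ge> 4 * (int t)\<^sup>2 - 7 * int t"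
  shows "int (local_chromatic_number (schrijver_graph n k)) = \<lceil>real t / 2\<rceil> + 1"
proof -
  let ?G = "schrijver_graph n k"
  obtain s where s: "t = 2 * s + 1" using \<open>odd t\<close> by (rule oddE)
  \<comment> \<open>As \<open>t > 2\<close>, the subtraction in \<open>4 * t - 7\<close> is not
    truncated.\<close>
  have "int (t * (4 * t - 7)) = 4 * (int t)\<^sup>2 - 7 * int t"
    using \<open>t > 2\<close> by (simp add: of_nat_diff power2_eq_square algebra_simps)
  then have "t * (4 * t - 7) \<le> n" using assms(7) by linarith
  then have upper: "local_chromatic_number ?G \<le> t div 2 + 2"
    using assms(2-5) by (intro local_chromatic_number_schrijver_le) auto
  interpret pair_graph ?G by (rule pair_graph_schrijver_graph) fact
  obtain c where c: "proper_coloring ?G c"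
    "local_chromatic_number ?G = Max ((\<lambda>v. card (c ` neighbourhood ?G v)) ` pverts ?G) + 1"
    using local_chromatic_number_attained by blast
  obtain v where v: "v \<in> pverts ?G" "(n - 2 * k + 1) div 2 + 1 \<le> card (c ` neighbourhood ?G v)"
    using schrijver_neighbourhood_colors[OF c(1) assms(2,3)] by (auto simp: schrijver_graph_def)
  have "card (c ` neighbourhood ?G v) \<le> Max ((\<lambda>v. card (c ` neighbourhood ?G v)) ` pverts ?G)"
    using v(1) pair_finite_verts by (intro Max_ge) auto
  \<comment> \<open>For \<open>t = 2 * s + 1\<close> the bounds meet:
    \<open>n - 2 * k + 1 = 2 * s\<close> gives a neighbourhood with \<open>s + 1\<close> colours,
    and \<open>t div 2 + 2 = s + 2\<close>.\<close>
  then have "local_chromatic_number ?G = s + 2" using upper c(2) v(2) assms(4) s by simp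
  moreover have "\<lceil>real t / 2\<rceil> = int s + 1" using s by (intro ceiling_unique) auto
  ultimately show ?thesis by simp
qed

end
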